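(* Let $f\in L^1(\mathbb{R}^N)$, $f\ge0$ a.e. If $N=1$ or $N=2$, assume in addition that $J$ is nonincreasing in the radial variable and that $0\le f\le g$ a.e. for some $g\in L^1(\mathbb{R}^N)\cap C_0(\mathbb{R}^N)$, $g\ge 0$, radial and strictly decreasing in the radial variable. If $u$ is the $L^1$-solution of the nonlocal Stefan problem $\partial_t u=J*v-v$, $v=(u-1)_+$, $u(\cdot,0)=f$, and $w$ is the solution of the nonlocal obstacle problem (OP) with data $f$, then $$u(t)\to f+J*w-w\quad\text{in }L^1(\mathbb{R}^N)\text{ as }t\to\infty .$$
   Context: Standing assumptions: $J:\mathbb{R}^N\to[0,\infty)$ is continuous, compactly supported, radially symmetric, and $\int_{\mathbb{R}^N}J=1$. Here $*$ is convolution in space and $s_+=\max\{s,0\}$. $C_0(\mathbb{R}^N)$ is the set of continuous functions tending to $0$ at infinity. For $f\in L^1(\mathbb{R}^N)$, the $L^1$-solution is the unique $u\in C([0,\infty);L^1(\mathbb{R}^N))$ such that for every $t>0$, $u(t)=f+\int_0^t(J*v(s)-v(s))\,ds$ with $v=(u-1)_+$ a.e. Nonlocal obstacle problem (OP): given a nonnegative $f\in L^1(\mathbb{R}^N)$, find a nonnegative $w\in L^1(\mathbb{R}^N)$ such that $$0\le f+J*w-w\le1,\qquad (f+J*w-w-1)\,w=0\quad\text{a.e.}$$ *)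

theory Defs
  imports "HOL-Analysis.Analysis"
begin

subsection \<open>The Banach space of Lebesgue integrable functions modulo null sets\<close>

definition L1_rel :: "('a::euclidean_space \<Rightarrow> real) \<Rightarrow> ('a \<Rightarrow> real) \<Rightarrow> bool" where
  "L1_rel f g \<longleftrightarrow> integrable lborel f \<and> integrable lborel g \<and> (AE x in lborel. f x = g x)"

lemma part_equivp_L1_rel: "part_equivp L1_rel"
proof (rule part_equivpI)
  show "\<exists>f::'a \<Rightarrow> real. L1_rel f f"
    by (rule exI[of _ "\<lambda>_. 0"]) (simp add: L1_rel_def)
  show "symp (L1_rel :: ('a \<Rightarrow> real) \<Rightarrow> _)"
    by (auto simp: symp_def L1_rel_def)
  show "transp (L1_rel :: ('a \<Rightarrow> real) \<Rightarrow> _)"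
    unfolding transp_def L1_rel_def by (auto elim!: eventually_elim2)
qed

text \<open>For integrable \<open>f\<close>, \<open>L1_of f\<close> is the class of \<open>f\<close>; it is unspecified for other \<open>f\<close>.
  \<open>fun_of u\<close> is some representative of the class \<open>u\<close>.\<close>

quotient_type (overloaded) 'a L1 = "'a::euclidean_space \<Rightarrow> real" / partial: L1_rel
  morphisms fun_of L1_of
  by (rule part_equivp_L1_rel)

lemma L1_rel_fun_of: "L1_rel (fun_of u) (fun_of u)"
  using Quotient_L1 by (rule Quotient_rep_reflp)

lemma integrable_fun_of [simp]: "integrable lborel (fun_of u)"
  using L1_rel_fun_of by (auto simp: L1_rel_def)

lemma L1_of_fun_of [simp]: "L1_of (fun_of u) = u"
  using Quotient_L1 by (rule Quotient_abs_rep)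

lemma L1_of_eq_iff:
  assumes "integrable lborel f" "integrable lborel g"
  shows "L1_of f = L1_of g \<longleftrightarrow> (AE x in lborel. f x = g x)"
  using Quotient_rel[OF Quotient_L1, of f g] assms by (simp add: L1_rel_def)

lemma fun_of_L1_of:
  assumes "integrable lborel f"
  shows "AE x in lborel. fun_of (L1_of f) x = f x"
  using L1_of_eq_iff[of "fun_of (L1_of f)" f] assms by simp

lemma L1_eq_iff: "u = v \<longleftrightarrow> (AE x in lborel. fun_of u x = fun_of v x)"
  using L1_of_eq_iff[of "fun_of u" "fun_of v"] by simp

instantiation L1 :: (euclidean_space) real_vector
begin

lift_definition zero_L1 :: "'a L1" is "\<lambda>_. 0"
  by (simp add: L1_rel_def)

lift_definition plus_L1 :: "'a L1 \<Rightarrow> 'a L1 \<Rightarrow> 'a L1" is "\<lambda>f g x. f x + g x"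
  unfolding L1_rel_def by (auto elim!: eventually_elim2)

lift_definition minus_L1 :: "'a L1 \<Rightarrow> 'a L1 \<Rightarrow> 'a L1" is "\<lambda>f g x. f x - g x"
  unfolding L1_rel_def by (auto elim!: eventually_elim2)

lift_definition uminus_L1 :: "'a L1 \<Rightarrow> 'a L1" is "\<lambda>f x. - f x"
  unfolding L1_rel_def by auto

lift_definition scaleR_L1 :: "real \<Rightarrow> 'a L1 \<Rightarrow> 'a L1" is "\<lambda>c f x. c * f x"
  unfolding L1_rel_def by auto

instance
proof
  fix u v w :: "'a L1" and a b :: real
  show "u + v + w = u + (v + w)" by transfer (simp add: L1_rel_def add.assoc)
  show "u + v = v + u" by transfer (simp add: L1_rel_def add.commute)
  show "0 + u = u" by transfer (simp add: L1_rel_def)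
  show "- u + u = 0" by transfer (simp add: L1_rel_def)
  show "u - v = u + - v" by transfer (simp add: L1_rel_def)
  show "a *\<^sub>R (u + v) = a *\<^sub>R u + a *\<^sub>R v" by transfer (simp add: L1_rel_def algebra_simps)
  show "(a + b) *\<^sub>R u = a *\<^sub>R u + b *\<^sub>R u" by transfer (simp add: L1_rel_def algebra_simps)
  show "a *\<^sub>R b *\<^sub>R u = (a * b) *\<^sub>R u" by transfer (simp add: L1_rel_def algebra_simps)
  show "1 *\<^sub>R u = u" by transfer (simp add: L1_rel_def)
qed

end

instantiation L1 :: (euclidean_space) real_normed_vector
begin

lift_definition norm_L1 :: "'a L1 \<Rightarrow> real" is "\<lambda>f. LINT x|lborel. \<bar>f x\<bar>"
  unfolding L1_rel_def by (auto intro!: integral_cong_AE)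

definition dist_L1 :: "'a L1 \<Rightarrow> 'a L1 \<Rightarrow> real" where
  "dist_L1 u v = norm (u - v)"

definition sgn_L1 :: "'a L1 \<Rightarrow> 'a L1" where
  "sgn_L1 u = u /\<^sub>R norm u"

definition uniformity_L1 :: "('a L1 \<times> 'a L1) filter" where
  "uniformity_L1 = (INF e\<in>{0<..}. principal {(u, v). dist u v < e})"

definition open_L1 :: "'a L1 set \<Rightarrow> bool" where
  "open_L1 U \<longleftrightarrow> (\<forall>u\<in>U. eventually (\<lambda>(u', v). u' = u \<longrightarrow> v \<in> U) uniformity)"

instance
proof
  fix u v :: "'a L1" and a :: real
  show "dist u v = norm (u - v)" by (rule dist_L1_def)
  show "sgn u = u /\<^sub>R norm u" by (rule sgn_L1_def)
  show "uniformity = (INF e\<in>{0<..}. principal {(u, v::'a L1). dist u v < e})"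
    by (rule uniformity_L1_def)
  show "open U \<longleftrightarrow> (\<forall>u\<in>U. eventually (\<lambda>(u', v). u' = u \<longrightarrow> v \<in> U) uniformity)"
    for U :: "'a L1 set" by (rule open_L1_def)
  show "norm u = 0 \<longleftrightarrow> u = 0"
    by transfer (auto simp: L1_rel_def integral_nonneg_eq_0_iff_AE)
  show "norm (u + v) \<le> norm u + norm v"
  proof transfer
    fix f g :: "'a \<Rightarrow> real" assume "L1_rel f f" "L1_rel g g"
    then have fg: "integrable lborel f" "integrable lborel g" by (auto simp: L1_rel_def)
    then have "(LINT x|lborel. \<bar>f x + g x\<bar>) \<le> (LINT x|lborel. \<bar>f x\<bar> + \<bar>g x\<bar>)"
      by (intro integral_mono) auto
    with fg show "(LINT x|lborel. \<bar>f x + g x\<bar>) \<le> (LINT x|lborel. \<bar>f x\<bar>) + (LINT x|lborel. \<bar>g x\<bar>)"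
      by simp
  qed
  show "norm (a *\<^sub>R u) = \<bar>a\<bar> * norm u"
    by transfer (simp add: abs_mult)
qed

end

lemma norm_L1_of: "integrable lborel f \<Longrightarrow> norm (L1_of f) = (LINT x|lborel. \<bar>f x\<bar>)"
  by (rule norm_L1.abs_eq) (simp add: L1_rel_def)

lemma norm_L1_fun_of: "norm u = (LINT x|lborel. \<bar>fun_of u x\<bar>)"
  using norm_L1_of[of "fun_of u"] by simp

lemma L1_of_diff:
  "integrable lborel f \<Longrightarrow> integrable lborel g \<Longrightarrow> L1_of f - L1_of g = L1_of (\<lambda>x. f x - g x)"
  by (rule minus_L1.abs_eq) (simp_all add: L1_rel_def)

lemma L1_of_add:
  "integrable lborel f \<Longrightarrow> integrable lborel g \<Longrightarrow> L1_of f + L1_of g = L1_of (\<lambda>x. f x + g x)"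
  by (rule plus_L1.abs_eq) (simp_all add: L1_rel_def)

lemma L1_of_sum:
  "(\<And>i. integrable lborel (F i)) \<Longrightarrow> (\<Sum>i<n::nat. L1_of (F i)) = L1_of (\<lambda>x. \<Sum>i<n. F i x)"
  by (induction n) (simp_all add: L1_of_add zero_L1_def)

lemma L1_summable:
  fixes U :: "nat \<Rightarrow> 'a::euclidean_space L1"
  assumes sum: "summable (\<lambda>n. norm (U n))"
  shows "\<exists>v. (\<lambda>n. \<Sum>i<n. U i) \<longlonglongrightarrow> v"
proof -
  define F where "F n = fun_of (U n)" for n
  have F [simp, measurable]: "integrable lborel (F n)" for n by (simp add: F_def)
  have norm_U: "norm (U n) = (LINT x|lborel. norm (F n x))" for n
    by (simp add: F_def norm_L1_fun_of)
  have F_meas [measurable]: "F n \<in> borel_measurable lborel" for n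
    using F by (rule borel_measurable_integrable)
  have "(\<integral>\<^sup>+x. (\<Sum>n. ennreal (norm (F n x))) \<partial>lborel) = (\<Sum>n. \<integral>\<^sup>+x. ennreal (norm (F n x)) \<partial>lborel)"
    by (rule nn_integral_suminf) auto
  also have "\<dots> = (\<Sum>n. ennreal (norm (U n)))"
    by (intro suminf_cong) (simp only: norm_U, rule nn_integral_eq_integral, auto)
  also have "\<dots> = ennreal (\<Sum>n. norm (U n))"
    by (rule suminf_ennreal2) (use sum in auto)
  finally have "AE x in lborel. (\<Sum>n. ennreal (norm (F n x))) \<noteq> \<infinity>"
    by (intro nn_integral_PInf_AE) auto
  then have ae: "AE x in lborel. summable (\<lambda>n. norm (F n x))"
    by eventually_elim (rule summable_suminf_not_top, auto)
  define h where "h x = (\<Sum>n. F n x)" for x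
  have int_sum: "summable (\<lambda>n. LINT x|lborel. norm (F n x))"
    using sum by (simp add: norm_U)
  have h: "integrable lborel h"
    unfolding h_def by (rule integrable_suminf[OF F ae int_sum])
  have tail: "norm ((\<Sum>i<n. U i) - L1_of h) \<le> (\<Sum>i. norm (U (i + n)))" for n
  proof -
    have ae_n: "AE x in lborel. summable (\<lambda>i. norm (norm (F (i + n) x)))"
      using ae
    proof eventually_elim
      case (elim x)
      then show ?case using summable_iff_shift[of "\<lambda>i. norm (F i x)" n] by simp
    qed
    have sum_n: "summable (\<lambda>i. LINT x|lborel. norm (norm (F (i + n) x)))"
      using int_sum summable_iff_shift[of "\<lambda>i. LINT x|lborel. norm (F i x)" n] by simp
    have int_n: "integrable lborel (\<lambda>x. \<Sum>i. norm (F (i + n) x))"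
      by (rule integrable_suminf[OF _ ae_n sum_n]) auto
    have "(\<Sum>i<n. U i) - L1_of h = L1_of (\<lambda>x. \<Sum>i<n. F i x) - L1_of h"
      using L1_of_sum[where F=F and n=n, OF F] by (simp add: F_def)
    also have "\<dots> = L1_of (\<lambda>x. (\<Sum>i<n. F i x) - h x)"
      by (rule L1_of_diff) (auto simp: h)
    finally have "norm ((\<Sum>i<n. U i) - L1_of h) = (LINT x|lborel. \<bar>(\<Sum>i<n. F i x) - h x\<bar>)"
      by (simp add: norm_L1_of h)
    also have "\<dots> \<le> (LINT x|lborel. (\<Sum>i. norm (F (i + n) x)))"
    proof (rule integral_mono_AE)
      show "AE x in lborel. \<bar>(\<Sum>i<n. F i x) - h x\<bar> \<le> (\<Sum>i. norm (F (i + n) x))"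
        using ae
      proof eventually_elim
        case (elim x)
        have s: "summable (\<lambda>i. norm (F (i + n) x))"
          using elim summable_iff_shift[of "\<lambda>i. norm (F i x)" n] by simp
        have "h x = (\<Sum>i. F (i + n) x) + (\<Sum>i<n. F i x)"
          unfolding h_def by (rule suminf_split_initial_segment[OF summable_norm_cancel[OF elim]])
        with summable_norm[OF s] show ?case by simp
      qed
    qed (use int_n h in auto)
    also have "\<dots> = (\<Sum>i. LINT x|lborel. norm (F (i + n) x))"
      by (rule integral_suminf[OF _ ae_n sum_n]) auto
    finally show ?thesis by (simp add: norm_U)
  qed
  have "(\<lambda>n. (\<Sum>i. norm (U (i + n)))) \<longlonglongrightarrow> 0"
    by (rule suminf_exist_split2[OF sum])
  then have "(\<lambda>n. (\<Sum>i<n. U i) - L1_of h) \<longlonglongrightarrow> 0"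
    by (rule Lim_null_comparison[OF always_eventually, rule_format, OF tail])
  then show ?thesis by (auto simp: LIM_zero_iff)
qed

instance L1 :: (euclidean_space) banach
proof
  fix X :: "nat \<Rightarrow> 'a L1" assume X: "Cauchy X"
  have "\<exists>M. \<forall>m\<ge>M. \<forall>k\<ge>M. dist (X m) (X k) < (1/2)^n" for n :: nat
    by (rule metric_CauchyD[OF X]) simp
  then obtain M where M: "\<And>n m k. m \<ge> M n \<Longrightarrow> k \<ge> M n \<Longrightarrow> dist (X m) (X k) < (1/2)^n"
    by metis
  define r where "r n = n + (\<Sum>i\<le>n. M i)" for n
  have rM: "r n \<ge> M n" for n
  proof -
    have "M n \<le> (\<Sum>i\<le>n. M i)" by (rule member_le_sum) auto
    then show ?thesis by (simp add: r_def)
  qed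
  have r: "strict_mono r" by (rule strict_mono_Suc_iff[THEN iffD2]) (simp add: r_def)
  have rS: "r (Suc n) \<ge> M n" for n
    using rM[of n] strict_monoD[OF r, of n "Suc n"] by simp
  have bd: "norm (norm (X (r (Suc n)) - X (r n))) \<le> (1/2)^n" for n
    using M[OF rS rM, of n] by (simp add: dist_norm)
  have "summable (\<lambda>n. norm (X (r (Suc n)) - X (r n)))"
    by (rule summable_comparison_test'[OF summable_geometric[of "1/2::real"], of 0]) (use bd in auto)
  from L1_summable[OF this] obtain v where "(\<lambda>n. \<Sum>i<n. X (r (Suc i)) - X (r i)) \<longlonglongrightarrow> v"
    by blast
  then have "(\<lambda>n. X (r n) - X (r 0)) \<longlonglongrightarrow> v"
    by (simp add: sum_lessThan_telescope[of "\<lambda>i. X (r i)"])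
  then have "(\<lambda>n. X (r n) - X (r 0) + X (r 0)) \<longlonglongrightarrow> v + X (r 0)"
    by (rule tendsto_add[OF _ tendsto_const])
  then have "(X \<circ> r) \<longlonglongrightarrow> v + X (r 0)"
    by (simp add: o_def)
  with X r have "X \<longlonglongrightarrow> v + X (r 0)"
    by (rule Cauchy_converges_subseq)
  then show "convergent X" by (rule convergentI)
qed

subsection \<open>Kernels and radial functions\<close>

definition radial :: "('a::real_normed_vector \<Rightarrow> real) \<Rightarrow> bool" where
  "radial h \<longleftrightarrow> (\<forall>x y. norm x = norm y \<longrightarrow> h x = h y)"

definition radially_nonincreasing :: "('a::real_normed_vector \<Rightarrow> real) \<Rightarrow> bool" where
  "radially_nonincreasing h \<longleftrightarrow> (\<forall>x y. norm x \<le> norm y \<longrightarrow> h y \<le> h x)"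

definition radially_strictly_decreasing :: "('a::real_normed_vector \<Rightarrow> real) \<Rightarrow> bool" where
  "radially_strictly_decreasing h \<longleftrightarrow> (\<forall>x y. norm x < norm y \<longrightarrow> h y < h x)"

definition admissible_kernel :: "('a::euclidean_space \<Rightarrow> real) \<Rightarrow> bool" where
  "admissible_kernel J \<longleftrightarrow> continuous_on UNIV J \<and> (\<forall>x. 0 \<le> J x) \<and> compact (closure {x. J x \<noteq> 0}) \<and>
     radial J \<and> (LINT x|lborel. J x) = 1"

definition C0 :: "('a::euclidean_space \<Rightarrow> real) set" where
  "C0 = {g. continuous_on UNIV g \<and> (g \<longlongrightarrow> 0) at_infinity}"

definition convolve ::
    "('a::euclidean_space \<Rightarrow> real) \<Rightarrow> ('a \<Rightarrow> real) \<Rightarrow> 'a \<Rightarrow> real" where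
  "convolve J h x = (LINT y|lborel. J (x - y) * h y)"

subsection \<open>The nonlocal Stefan problem and the nonlocal obstacle problem\<close>

definition positive_excess :: "'a::euclidean_space L1 \<Rightarrow> 'a \<Rightarrow> real" where
  "positive_excess u x = max (fun_of u x - 1) 0"

text \<open>For an admissible kernel \<open>J\<close> the function under \<open>L1_of\<close> is integrable, its class depends only on the
  class \<open>u s\<close>, and the path \<open>s \<mapsto> J * v(s) - v(s)\<close> in the Banach space \<open>L1\<close> is continuous
  whenever \<open>u\<close> is, so the \<open>L1\<close>-valued integral exists. The initial condition \<open>u 0 = L1_of f\<close>
  follows by letting \<open>t\<close> tend to \<open>0\<close>.\<close>

definition L1_solution ::
    "('a::euclidean_space \<Rightarrow> real) \<Rightarrow> ('a \<Rightarrow> real) \<Rightarrow> (real \<Rightarrow> 'a L1) \<Rightarrow> bool" where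
  "L1_solution J f u \<longleftrightarrow> continuous_on {0..} u \<and>
     (\<forall>t>0. u t = L1_of f + integral {0..t}
        (\<lambda>s. let v = positive_excess (u s) in L1_of (\<lambda>x. convolve J v x - v x)))"

definition obstacle_solution ::
    "('a::euclidean_space \<Rightarrow> real) \<Rightarrow> ('a \<Rightarrow> real) \<Rightarrow> ('a \<Rightarrow> real) \<Rightarrow> bool" where
  "obstacle_solution J f w \<longleftrightarrow> integrable lborel w \<and> (AE x in lborel. 0 \<le> w x) \<and>
     (AE x in lborel. 0 \<le> f x + convolve J w x - w x \<and> f x + convolve J w x - w x \<le> 1) \<and>
     (AE x in lborel. (f x + convolve J w x - w x - 1) * w x = 0)"

end

theory Submission
  imports Defs
begin

text \<open>Let \<open>W t = \<integral>\<^sub>0\<^sup>t v\<close>, so that \<open>u t = f + J * W t - W t\<close>. Since \<open>u\<close> can never drop below \<open>1\<close>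
  again, \<open>u t \<ge> 1\<close> wherever \<open>W t > 0\<close>; as \<open>f + J * w - w \<le> 1\<close>, the difference \<open>z = W t - w\<close>
  satisfies \<open>z \<le> J * z\<close> where \<open>z > 0\<close>. Then \<open>z\<^sub>+ \<le> J * z\<^sub>+\<close>, both sides have the same integral,
  and an integrable fixed point of \<open>J *\<close> vanishes by the maximum principle; hence \<open>W t \<le> w\<close>.
  The increasing family \<open>W t\<close> therefore converges in \<open>L1\<close>, to \<open>L\<close> say, where \<open>f + J * L - L \<le> 1\<close>.
  The same comparison applied to \<open>w - L\<close> gives \<open>w \<le> L\<close>, so \<open>L = w\<close>.\<close>

text \<open>The zero set is closed, and a closed set of full Lebesgue measure is the whole space
  because its complement is open and null.\<close>

lemma AE_zero_imp_zero_continuous: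
  fixes g :: "'a::euclidean_space \<Rightarrow> real"
  assumes "continuous_on UNIV g" and "AE x in lborel. g x = 0"
  shows "g x = 0"
proof -
  have "closed {x. g x = 0}"
    using continuous_closed_preimage[OF assms(1) closed_UNIV, of "{0}"]
    by (simp add: vimage_def)
  moreover have "AE x in lebesgue. x \<in> {x. g x = 0}"
    using assms(2) by (simp add: AE_completion)
  ultimately show ?thesis
    using mem_closed_if_AE_lebesgue by blast
qed

lemma integrable_excess:
  assumes "integrable lborel h"
  shows "integrable lborel (\<lambda>x. max (h x - 1) 0 :: real)"
  by (rule Bochner_Integration.integrable_bound[OF assms]) (use assms in auto)

section \<open>Convolution with the kernel: mass conservation, continuity, decay at infinity\<close>

locale kernel =
  fixes J :: "'a::euclidean_space \<Rightarrow> real"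
  assumes admissible: "admissible_kernel J"
begin

lemma cont: "continuous_on UNIV J"
  and nonneg: "0 \<le> J x"
  and support_compact: "compact (closure {x. J x \<noteq> 0})"
  and integral_eq_1: "(LINT x|lborel. J x) = 1"
  using admissible by (simp_all add: admissible_kernel_def)

lemma symmetric: "J (x - y) = J (y - x)"
  using admissible norm_minus_commute[of x y] unfolding admissible_kernel_def radial_def by blast

lemma borel [measurable]: "J \<in> borel_measurable borel"
  using cont by (rule borel_measurable_continuous_onI)

text \<open>The Bochner integral of a non-integrable function is 0 by convention, so the value 1
  forces integrability.\<close>

lemma integrable_J: "integrable lborel J"
  by (rule ccontr) (use integral_eq_1 not_integrable_integral_eq in force)

lemma integrable_shift: "integrable lborel (\<lambda>x. J (x - y))"
proof -
  have "integrable (distr lborel borel ((+) (- y))) J"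
    using integrable_J by (simp add: lborel_distr_plus)
  then show ?thesis
    by (subst (asm) integrable_distr_eq) auto
qed

lemma integral_shift: "(LINT x|lborel. J (x - y)) = 1"
proof -
  have "(LINT x|lborel. J x) = (LINT x|distr lborel borel ((+) (- y)). J x)"
    by (simp add: lborel_distr_plus)
  also have "\<dots> = (LINT x|lborel. J (x - y))"
    by (subst integral_distr) auto
  finally show ?thesis
    using integral_eq_1 by simp
qed

lemma bounded: obtains M where "0 \<le> M" "\<And>x. \<bar>J x\<bar> \<le> M"
proof -
  have "compact (J ` closure {x. J x \<noteq> 0})"
    by (rule compact_continuous_image[OF continuous_on_subset[OF cont subset_UNIV] support_compact])
  then obtain B where B: "\<And>y. y \<in> J ` closure {x. J x \<noteq> 0} \<Longrightarrow> norm y \<le> B"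
    using compact_imp_bounded bounded_iff by metis
  have "\<bar>J x\<bar> \<le> max B 0" for x
  proof (cases "J x = 0")
    case False
    then have "J x \<in> J ` closure {x. J x \<noteq> 0}"
      using closure_subset[of "{x. J x \<noteq> 0}"] by blast
    then show ?thesis using B by fastforce
  qed simp
  then show thesis by (intro that[of "max B 0"]) auto
qed

lemma eq_0_far: obtains R where "\<And>x. R < norm x \<Longrightarrow> J x = 0"
proof -
  obtain R where R: "\<And>x. x \<in> closure {x. J x \<noteq> 0} \<Longrightarrow> norm x \<le> R"
    using compact_imp_bounded[OF support_compact] bounded_iff by metis
  have "J x = 0" if "R < norm x" for x
    using R[of x] closure_subset[of "{x. J x \<noteq> 0}"] that by (meson linorder_not_less mem_Collect_eq subsetD)
  then show thesis by (rule that)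
qed

text \<open>Since \<open>J\<close> is bounded, the integral defining \<open>convolve J h x\<close>
  exists at every \<open>x\<close>, not merely almost every one. This makes
  \<open>convolve J h\<close> a genuine pointwise function.\<close>

lemma integrable_integrand:
  assumes "integrable lborel h"
  shows "integrable lborel (\<lambda>y. J (x - y) * h y)"
proof -
  obtain M where M: "0 \<le> M" "\<And>x. \<bar>J x\<bar> \<le> M" by (rule bounded) auto
  show ?thesis
    by (rule Bochner_Integration.integrable_bound[OF integrable_mult_right[OF assms, of M]])
      (use assms M in \<open>auto simp: abs_mult intro!: mult_right_mono\<close>)
qed

lemma convolve_cong_AE:
  assumes "integrable lborel g" "integrable lborel h" "AE x in lborel. g x = h x"
  shows "convolve J g x = convolve J h x"
  unfolding convolve_def by (rule integral_cong_AE) (use assms in auto)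

lemma convolve_mono:
  assumes "integrable lborel g" "integrable lborel h" "AE x in lborel. g x \<le> h x"
  shows "convolve J g x \<le> convolve J h x"
  unfolding convolve_def
proof (rule integral_mono_AE)
  show "AE y in lborel. J (x - y) * g y \<le> J (x - y) * h y"
    using assms(3) by eventually_elim (simp add: mult_left_mono nonneg)
qed (use assms integrable_integrand in auto)

text \<open>Tonelli with \<open>x\<close> as the inner variable: there the shifted kernel has mass
  1, so the inner integral of the absolute value is just \<open>\<bar>h y\<bar>\<close>.\<close>

lemma integrable_convolution_pair:
  assumes "integrable lborel h"
  shows "integrable (lborel \<Otimes>\<^sub>M lborel) (\<lambda>(y, x). J (x - y) * h y)"
proof -
  have [measurable]: "h \<in> borel_measurable borel" using assms by auto
  show ?thesis
  proof (rule lborel_pair.Fubini_integrable)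
    have "(LINT x|lborel. norm (case (y, x) of (y, x) \<Rightarrow> J (x - y) * h y)) = \<bar>h y\<bar>" for y
      using integral_shift[of y] by (simp add: abs_mult nonneg)
    then show "integrable lborel (\<lambda>y. LINT x|lborel. norm (case (y, x) of (y, x) \<Rightarrow> J (x - y) * h y))"
      using assms by simp
    show "AE y in lborel. integrable lborel (\<lambda>x. case (y, x) of (y, x) \<Rightarrow> J (x - y) * h y)"
      using integrable_shift by auto
  qed measurable
qed

lemma integrable_convolve:
  assumes "integrable lborel h"
  shows "integrable lborel (convolve J h)"
  using lborel_pair.integrable_fst'[OF lborel_pair.integrable_product_swap[OF integrable_convolution_pair[OF assms]]]
  by (simp add: convolve_def [abs_def])

text \<open>Conservation of mass: after exchanging the order of integration, the inner integral of
  the shifted kernel equals 1.\<close>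

lemma integral_convolve:
  assumes "integrable lborel h"
  shows "(LINT x|lborel. convolve J h x) = (LINT x|lborel. h x)"
proof -
  note int = integrable_convolution_pair[OF assms]
  have "(LINT x|lborel. convolve J h x) =
      (LINT z|(lborel \<Otimes>\<^sub>M lborel). (\<lambda>(x, y). J (x - y) * h y) z)"
    using lborel_pair.integral_fst'[OF lborel_pair.integrable_product_swap[OF int]]
    by (simp add: convolve_def)
  also have "\<dots> = (LINT z|(lborel \<Otimes>\<^sub>M lborel). (\<lambda>(y, x). J (x - y) * h y) z)"
    using lborel_pair.integral_product_swap[of "\<lambda>(y, x). J (x - y) * h y"] int by auto
  also have "\<dots> = (LINT y|lborel. LINT x|lborel. J (x - y) * h y)"
    using lborel_pair.integral_fst'[OF int] by simp
  also have "\<dots> = (LINT y|lborel. h y)"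
    using integral_shift by simp
  finally show ?thesis .
qed

text \<open>Dominated convergence with majorant a bound of \<open>J\<close> times
  \<open>\<bar>h\<bar>\<close>. It is used twice: with \<open>k\<close> a shift of \<open>J\<close>
  for continuity, and with \<open>k = 0\<close> for decay.\<close>

lemma convolve_LIMSEQ_dominated:
  assumes h: "integrable lborel h" and lim: "\<And>y. (\<lambda>n. J (X n - y)) \<longlonglongrightarrow> k y"
    and [measurable]: "k \<in> borel_measurable borel"
  shows "(\<lambda>n. convolve J h (X n)) \<longlonglongrightarrow> (LINT y|lborel. k y * h y)"
proof -
  obtain M where M: "0 \<le> M" "\<And>x. \<bar>J x\<bar> \<le> M" by (rule bounded) auto
  have [measurable]: "h \<in> borel_measurable borel" using h by auto
  show ?thesis
    unfolding convolve_def
  proof (rule integral_dominated_convergence)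
    show "integrable lborel (\<lambda>y. M * \<bar>h y\<bar>)" using h by simp
    show "AE y in lborel. (\<lambda>n. J (X n - y) * h y) \<longlonglongrightarrow> k y * h y"
      using lim by (auto intro!: tendsto_intros)
    show "AE y in lborel. norm (J (X n - y) * h y) \<le> M * \<bar>h y\<bar>" for n
      using M by (auto simp: abs_mult intro!: mult_right_mono)
  qed measurable
qed

lemma continuous_convolve:
  assumes "integrable lborel h"
  shows "continuous_on UNIV (convolve J h)"
proof (rule continuous_at_imp_continuous_on, rule ballI)
  fix x
  have "(\<lambda>n. convolve J h (X n)) \<longlonglongrightarrow> convolve J h x" if "X \<longlonglongrightarrow> x" for X
  proof -
    have "(\<lambda>n. J (X n - y)) \<longlonglongrightarrow> J (x - y)" for y
      by (rule continuous_on_tendsto_compose[OF cont])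
        (use that in \<open>auto intro: tendsto_intros\<close>)
    from convolve_LIMSEQ_dominated[OF assms this] show ?thesis
      by (simp add: convolve_def)
  qed
  then show "isCont (convolve J h) x"
    by (simp add: continuous_at_sequentially o_def)
qed

lemma convolve_LIMSEQ_0:
  assumes h: "integrable lborel h" and X: "filterlim (\<lambda>n. norm (X n)) at_top sequentially"
  shows "(\<lambda>n. convolve J h (X n)) \<longlonglongrightarrow> 0"
proof -
  obtain R where R: "\<And>x. R < norm x \<Longrightarrow> J x = 0" by (rule eq_0_far) auto
  have "(\<lambda>n. J (X n - y)) \<longlonglongrightarrow> 0" for y
  proof (rule tendsto_eventually)
    have "\<forall>\<^sub>F n in sequentially. norm y + R < norm (X n)"
      using X by (simp add: filterlim_at_top_dense)
    then show "\<forall>\<^sub>F n in sequentially. J (X n - y) = 0"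
    proof eventually_elim
      case (elim n)
      with norm_triangle_ineq2[of "X n" y] show ?case by (intro R) linarith
    qed
  qed
  from convolve_LIMSEQ_dominated[OF h this] show ?thesis by simp
qed

lemma convolve_small_far:
  assumes "integrable lborel h" "0 < e"
  obtains R where "\<And>x. R \<le> norm x \<Longrightarrow> \<bar>convolve J h x\<bar> < e"
proof (rule ccontr)
  assume "\<not> thesis"
  then have "\<exists>x. real n \<le> norm x \<and> e \<le> \<bar>convolve J h x\<bar>" for n
    using that[of "real n"] by (meson linorder_not_less)
  then obtain X where X: "\<And>n. real n \<le> norm (X n)" "\<And>n. e \<le> \<bar>convolve J h (X n)\<bar>"
    by metis
  have "filterlim (\<lambda>n. norm (X n)) at_top sequentially"
    by (rule filterlim_at_top_mono[OF filterlim_real_sequentially]) (use X in auto)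
  from tendsto_rabs[OF convolve_LIMSEQ_0[OF assms(1) this]]
  have "(\<lambda>n. \<bar>convolve J h (X n)\<bar>) \<longlonglongrightarrow> 0" by simp
  then have "e \<le> 0" by (rule LIMSEQ_le_const) (use X in auto)
  with \<open>0 < e\<close> show False by simp
qed

section \<open>Maximum principle and comparison for the kernel\<close>

text \<open>A point is a null set, so a kernel vanishing off the origin would have integral 0. The
  vector \<open>z\<close> supplies a direction in which to run off to infinity.\<close>

lemma nonzero_off_origin: obtains z where "z \<noteq> 0" "J z \<noteq> 0"
proof (rule ccontr)
  assume "\<not> thesis"
  then have "\<And>z. z \<noteq> 0 \<Longrightarrow> J z = 0" using that by auto
  then have "AE z in lborel. J z = 0"
    using AE_lborel_singleton[of 0] by auto
  then have "(LINT z|lborel. J z) = 0" by (rule integral_eq_zero_AE)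
  then show False using integral_eq_1 by simp
qed

text \<open>A maximum of \<open>h\<close> propagates from \<open>x\<close> to all points \<open>x - n *\<^sub>R z\<close> with \<open>J z > 0\<close>, which
  contradicts the decay of \<open>convolve J h\<close>. Note that \<open>J 0 > 0\<close> is not assumed.\<close>

lemma convolve_fixed_point_nonpos:
  assumes h: "integrable lborel h" and fixp: "\<And>x. convolve J h x = h x"
  shows "h x \<le> 0"
proof (rule ccontr)
  assume "\<not> h x \<le> 0"
  then have pos: "0 < h x" by simp
  have ch: "continuous_on UNIV h"
    using continuous_convolve[OF h] fixp by (simp add: fun_eq_iff[THEN iffD2])
  \<comment> \<open>Outside the ball of radius \<open>R\<close> the values stay below
    \<open>h x\<close>, so the maximum over the compact ball is a global one.\<close>
  obtain R where R: "\<And>y. R \<le> norm y \<Longrightarrow> \<bar>h y\<bar> < h x"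
    using convolve_small_far[OF h pos] fixp by metis
  have "x \<in> cball 0 R" using R[of x] pos by (cases "R \<le> norm x") auto
  then have "cball 0 R \<noteq> ({} :: 'a set)" by blast
  from continuous_attains_sup[OF compact_cball this continuous_on_subset[OF ch subset_UNIV]]
  obtain m where m: "\<And>y. y \<in> cball 0 R \<Longrightarrow> h y \<le> h m" by blast
  have max: "h y \<le> h m" for y
  proof (cases "R \<le> norm y")
    case True
    then have "h y < h x" using R[of y] by simp
    also have "h x \<le> h m" using m \<open>x \<in> cball 0 R\<close> by simp
    finally show ?thesis by simp
  next
    case False
    then show ?thesis using m by simp
  qed
  \<comment> \<open>At a maximum point \<open>a\<close>, the gap \<open>h m - h y\<close> has
    weighted mean 0 against \<open>J (a - y)\<close>. The integrand is nonnegative and continuous,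
    hence zero everywhere; at \<open>y = a - z\<close> its weight is \<open>J z\<close>.\<close>
  have step: "h (a - z) = h m" if a: "h a = h m" and z: "J z \<noteq> 0" for a z
  proof -
    have int: "integrable lborel (\<lambda>y. J (a - y))"
      using integrable_shift[of a] symmetric by simp
    have intd: "integrable lborel (\<lambda>y. J (a - y) * (h m - h y))"
      using int integrable_integrand[OF h, of a] by (simp add: right_diff_distrib)
    have "(LINT y|lborel. J (a - y) * (h m - h y)) = (LINT y|lborel. J (a - y)) * h m - convolve J h a"
      using int integrable_integrand[OF h, of a] by (simp add: right_diff_distrib convolve_def)
    also have "\<dots> = 0"
      using integral_shift[of a] symmetric a fixp by simp
    finally have "AE y in lborel. J (a - y) * (h m - h y) = 0"
      using integral_nonneg_eq_0_iff_AE[OF intd] nonneg max by simp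
    moreover have "continuous_on UNIV (\<lambda>y. J (a - y) * (h m - h y))"
      by (intro continuous_intros ch continuous_on_compose2[OF cont]) auto
    ultimately have "J (a - (a - z)) * (h m - h (a - z)) = 0"
      using AE_zero_imp_zero_continuous by blast
    then show ?thesis using z by simp
  qed
  obtain z where z: "z \<noteq> 0" "J z \<noteq> 0" by (rule nonzero_off_origin)
  have iter: "h (m - real n *\<^sub>R z) = h m" for n
  proof (induction n)
    case (Suc n)
    from step[OF Suc z(2)] show ?case by (simp add: algebra_simps)
  qed simp
  have "filterlim (\<lambda>n. norm (m - real n *\<^sub>R z)) at_top sequentially"
  proof (rule filterlim_at_top_mono)
    show "filterlim (\<lambda>n. - norm m + real n * norm z) at_top sequentially"
      using z filterlim_real_sequentially
      by (intro filterlim_tendsto_add_at_top[OF tendsto_const]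
          filterlim_at_top_mult_tendsto_pos[OF tendsto_const]) auto
    show "\<forall>\<^sub>F n in sequentially. - norm m + real n * norm z \<le> norm (m - real n *\<^sub>R z)"
    proof (intro always_eventually allI)
      show "- norm m + real n * norm z \<le> norm (m - real n *\<^sub>R z)" for n
        using norm_triangle_ineq2[of "real n *\<^sub>R z" m] by (simp add: norm_minus_commute)
    qed
  qed
  from convolve_LIMSEQ_0[OF h this] have "(\<lambda>n::nat. h m) \<longlonglongrightarrow> 0"
    by (simp add: fixp iter)
  then have "h m = 0" by (simp add: LIMSEQ_const_iff)
  with pos max[of x] show False by simp
qed

lemma comparison:
  assumes z: "integrable lborel z"
    and sub: "AE x in lborel. 0 < z x \<longrightarrow> z x \<le> convolve J z x"
  shows "AE x in lborel. z x \<le> 0"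
proof -
  define p where "p x = max (z x) 0" for x
  have p: "integrable lborel p"
    unfolding p_def using z by simp
  have "convolve J z x \<le> convolve J p x" "0 \<le> convolve J p x" for x
    using convolve_mono[OF z p, of x] nonneg by (auto simp: p_def convolve_def)
  \<comment> \<open>Where \<open>z\<close> is positive the hypothesis applies and
    \<open>J * z \<le> J * p\<close>; elsewhere \<open>p\<close> is 0 and
    \<open>J * p \<ge> 0\<close>.\<close>
  then have le: "AE x in lborel. 0 \<le> convolve J p x - p x"
    using sub by (auto simp: p_def max_def elim!: eventually_mono intro: order_trans)
  have int: "integrable lborel (\<lambda>x. convolve J p x - p x)"
    using p integrable_convolve[OF p] by simp
  have "(LINT x|lborel. convolve J p x - p x) = 0"
    using p integrable_convolve[OF p] integral_convolve[OF p] by simp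
  then have eq: "AE x in lborel. convolve J p x = p x"
    using integral_nonneg_eq_0_iff_AE[OF int le] by simp
  \<comment> \<open>Convolving once more turns the a.e. equality into an identity at every point, as
    the fixed point lemma requires.\<close>
  have "convolve J (convolve J p) x = convolve J p x" for x
    by (rule convolve_cong_AE[OF integrable_convolve[OF p] p eq])
  then have nonpos: "convolve J p x \<le> 0" for x
    using convolve_fixed_point_nonpos[OF integrable_convolve[OF p]] by blast
  from eq have "AE x in lborel. p x \<le> 0"
    by eventually_elim (metis nonpos)
  then show ?thesis
    by (auto simp: p_def)
qed

end

section \<open>Almost-everywhere order on \<open>L1\<close> classes, tested by integrals over Borel
  sets\<close>

lemma fun_of_add: "AE x in lborel. fun_of (g + h) x = fun_of g x + fun_of h x"
  using L1_of_add[of "fun_of g" "fun_of h"] fun_of_L1_of[of "\<lambda>x. fun_of g x + fun_of h x"] by simp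

lemma fun_of_diff: "AE x in lborel. fun_of (g - h) x = fun_of g x - fun_of h x"
  using L1_of_diff[of "fun_of g" "fun_of h"] fun_of_L1_of[of "\<lambda>x. fun_of g x - fun_of h x"] by simp

lemma fun_of_scaleR: "AE x in lborel. fun_of (c *\<^sub>R h) x = c * fun_of h x"
proof -
  have "c *\<^sub>R L1_of (fun_of h) = L1_of (\<lambda>x. c * fun_of h x)"
    by (rule scaleR_L1.abs_eq) (simp add: L1_rel_def)
  then show ?thesis
    using fun_of_L1_of[of "\<lambda>x. c * fun_of h x"] by simp
qed

lemma fun_of_measurable [measurable]: "fun_of h \<in> borel_measurable borel"
  using borel_measurable_integrable[OF integrable_fun_of[of h]] by simp

text \<open>These bounded linear functionals detect signs of classes and commute with
  \<open>L1\<close>-valued integrals and limits, so a.e. inequalities can be carried through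
  both.\<close>

definition integral_on :: "'a::euclidean_space set \<Rightarrow> 'a L1 \<Rightarrow> real" where
  "integral_on A h = (LINT x|lborel. fun_of h x * indicator A x)"

lemma integrable_on_fun_of:
  assumes "A \<in> sets borel"
  shows "integrable lborel (\<lambda>x. fun_of h x * indicator A x)"
  using assms by (intro integrable_real_mult_indicator) auto

lemma integral_on_UNIV: "integral_on UNIV h = (LINT x|lborel. fun_of h x)"
  by (simp add: integral_on_def)

lemma bounded_linear_integral_on:
  assumes A: "A \<in> sets borel"
  shows "bounded_linear (integral_on A)"
proof (rule bounded_linear_intro[where K=1])
  note int = integrable_on_fun_of[OF A]
  note [measurable] = A
  fix g h :: "'a L1" and c :: real
  have "integral_on A (g + h) = (LINT x|lborel. fun_of g x * indicator A x + fun_of h x * indicator A x)"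
    unfolding integral_on_def
    by (rule integral_cong_AE) (use fun_of_add[of g h] in \<open>auto simp: algebra_simps elim!: eventually_mono\<close>)
  then show "integral_on A (g + h) = integral_on A g + integral_on A h"
    using int by (simp add: integral_on_def)
  have "integral_on A (c *\<^sub>R h) = (LINT x|lborel. c * (fun_of h x * indicator A x))"
    unfolding integral_on_def
    by (rule integral_cong_AE) (use fun_of_scaleR[of c h] in \<open>auto simp: algebra_simps elim!: eventually_mono\<close>)
  then show "integral_on A (c *\<^sub>R h) = c *\<^sub>R integral_on A h"
    by (simp add: integral_on_def)
  have "\<bar>integral_on A h\<bar> \<le> (LINT x|lborel. \<bar>fun_of h x * indicator A x\<bar>)"
    unfolding integral_on_def by (rule integral_abs_bound)
  also have "\<dots> \<le> (LINT x|lborel. \<bar>fun_of h x\<bar>)"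
    using int by (intro integral_mono) (auto simp: indicator_def)
  finally show "norm (integral_on A h) \<le> norm h * 1"
    by (simp add: norm_L1_fun_of)
qed

lemma integral_on_mono:
  assumes A: "A \<in> sets borel" and le: "AE x in lborel. x \<in> A \<longrightarrow> fun_of g x \<le> fun_of h x"
  shows "integral_on A g \<le> integral_on A h"
  unfolding integral_on_def
  by (rule integral_mono_AE)
    (use le integrable_on_fun_of[OF A] in \<open>auto simp: indicator_def elim!: eventually_mono\<close>)

lemma integral_on_nonneg:
  assumes "AE x in lborel. 0 \<le> fun_of h x"
  shows "0 \<le> integral_on A h"
  unfolding integral_on_def
  by (rule integral_nonneg_AE) (use assms in \<open>auto elim!: eventually_mono\<close>)

lemma integral_on_eq_0D:
  assumes A: "A \<in> sets borel" and h: "AE x in lborel. x \<in> A \<longrightarrow> 0 \<le> fun_of h x"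
    and le: "integral_on A h \<le> 0"
  shows "AE x in lborel. x \<in> A \<longrightarrow> fun_of h x = 0"
proof -
  have nn: "AE x in lborel. 0 \<le> fun_of h x * indicator A x"
    using h by (auto simp: indicator_def elim!: eventually_mono)
  then have "(LINT x|lborel. fun_of h x * indicator A x) = 0"
    using le integral_nonneg_AE[OF nn] by (simp add: integral_on_def)
  then show ?thesis
    using integral_nonneg_eq_0_iff_AE[OF integrable_on_fun_of[OF A] nn]
    by (auto simp: indicator_def elim!: eventually_mono)
qed

text \<open>For the nontrivial direction, test with the set where the representative is negative:
  the integral there is both nonnegative and nonpositive.\<close>

lemma fun_of_nonneg_iff:
  "(AE x in lborel. 0 \<le> fun_of h x) \<longleftrightarrow> (\<forall>A\<in>sets borel. 0 \<le> integral_on A h)"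
proof safe
  assume *: "\<forall>A\<in>sets borel. 0 \<le> integral_on A h"
  define A where "A = {x. fun_of h x < 0}"
  have A: "A \<in> sets borel" unfolding A_def by measurable
  have neg: "AE x in lborel. fun_of (- h) x = - fun_of h x"
    using fun_of_scaleR[of "-1" h] by simp
  have "integral_on A (- h) = - integral_on A h"
    using bounded_linear_integral_on[OF A] by (simp add: linear_simps)
  then have "AE x in lborel. x \<in> A \<longrightarrow> fun_of (- h) x = 0"
    using neg * A by (intro integral_on_eq_0D) (auto simp: A_def elim!: eventually_mono)
  then show "AE x in lborel. 0 \<le> fun_of h x"
    using neg by eventually_elim (auto simp: A_def)
qed (rule integral_on_nonneg)

text \<open>Representatives are chosen separately at each time, so the integral is not evaluated
  pointwise in space; each functional \<open>integral_on A\<close> is moved under it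
  instead.\<close>

lemma fun_of_integral_nonneg:
  fixes V :: "real \<Rightarrow> 'a::euclidean_space L1"
  assumes V: "V integrable_on S" and nonneg: "\<And>s. s \<in> S \<Longrightarrow> AE x in lborel. 0 \<le> fun_of (V s) x"
  shows "AE x in lborel. 0 \<le> fun_of (integral S V) x"
  unfolding fun_of_nonneg_iff
proof
  fix A :: "'a set" assume A: "A \<in> sets borel"
  have "0 \<le> integral S (integral_on A \<circ> V)"
    by (rule Henstock_Kurzweil_Integration.integral_nonneg
        [OF integrable_linear[OF V bounded_linear_integral_on[OF A]]])
      (simp add: integral_on_nonneg nonneg)
  then show "0 \<le> integral_on A (integral S V)"
    using integral_linear[OF V bounded_linear_integral_on[OF A]] by simp
qed

section \<open>Truncation and dispersal as operators on \<open>L1\<close>\<close>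

definition excess :: "'a::euclidean_space L1 \<Rightarrow> 'a L1" where
  "excess h = L1_of (positive_excess h)"

lemma fun_of_excess: "AE x in lborel. fun_of (excess h) x = max (fun_of h x - 1) 0"
  using fun_of_L1_of[OF integrable_excess[OF integrable_fun_of[of h]]]
  by (simp add: excess_def positive_excess_def [abs_def])

text \<open>The real map \<open>s \<mapsto> max (s - 1) 0\<close> is 1-Lipschitz; integrate this
  pointwise bound.\<close>

lemma dist_excess_le: "dist (excess g) (excess h) \<le> dist g h"
proof -
  have "AE x in lborel. \<bar>fun_of (excess g - excess h) x\<bar> \<le> \<bar>fun_of (g - h) x\<bar>"
    using fun_of_excess[of g] fun_of_excess[of h] fun_of_diff[of g h]
      fun_of_diff[of "excess g" "excess h"]
    by eventually_elim auto
  then show ?thesis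
    unfolding dist_norm norm_L1_fun_of by (intro integral_mono_AE) auto
qed

lemma continuous_on_excess: "continuous_on S excess"
proof (rule continuous_on_subset[OF _ subset_UNIV])
  have "1-lipschitz_on UNIV (excess :: 'a L1 \<Rightarrow> 'a L1)"
    by (rule lipschitz_onI) (simp_all add: dist_excess_le)
  then show "continuous_on UNIV (excess :: 'a L1 \<Rightarrow> 'a L1)"
    by (rule lipschitz_on_continuous_on)
qed

context kernel
begin

definition dispersal :: "'a L1 \<Rightarrow> 'a L1" where
  "dispersal h = L1_of (\<lambda>x. convolve J (fun_of h) x - fun_of h x)"

lemma fun_of_dispersal:
  "AE x in lborel. fun_of (dispersal h) x = convolve J (fun_of h) x - fun_of h x"
  unfolding dispersal_def by (rule fun_of_L1_of) (simp add: integrable_convolve)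

lemma dispersal_L1_of:
  assumes "integrable lborel h"
  shows "dispersal (L1_of h) = L1_of (\<lambda>x. convolve J h x - h x)"
  unfolding dispersal_def
  using fun_of_L1_of[OF assms] assms
  by (subst L1_of_eq_iff)
    (auto simp: integrable_convolve convolve_cong_AE[OF integrable_fun_of assms fun_of_L1_of[OF assms]])

lemma abs_convolve_le: "integrable lborel h \<Longrightarrow> \<bar>convolve J h x\<bar> \<le> convolve J (\<lambda>x. \<bar>h x\<bar>) x"
  unfolding convolve_def
  by (rule order_trans[OF integral_abs_bound]) (simp add: abs_mult nonneg)

lemma bounded_linear_dispersal: "bounded_linear dispersal"
proof (rule bounded_linear_intro[where K=2])
  fix g h :: "'a L1" and c :: real
  note int = integrable_integrand[OF integrable_fun_of]
  have "convolve J (fun_of (g + h)) x = convolve J (\<lambda>x. fun_of g x + fun_of h x) x" for x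
    by (rule convolve_cong_AE[OF _ _ fun_of_add]) auto
  then have conv: "convolve J (fun_of (g + h)) x = convolve J (fun_of g) x + convolve J (fun_of h) x" for x
    using int[where x=x] by (simp add: convolve_def distrib_left)
  have "AE x in lborel. fun_of (dispersal (g + h)) x = fun_of (dispersal g + dispersal h) x"
    using fun_of_add[of g h] fun_of_add[of "dispersal g" "dispersal h"]
      fun_of_dispersal[of g] fun_of_dispersal[of h] fun_of_dispersal[of "g + h"]
    by eventually_elim (simp add: conv)
  then show "dispersal (g + h) = dispersal g + dispersal h"
    by (simp add: L1_eq_iff)
  have "convolve J (fun_of (c *\<^sub>R h)) x = convolve J (\<lambda>x. c * fun_of h x) x" for x
    by (rule convolve_cong_AE[OF _ _ fun_of_scaleR]) auto
  then have conv: "convolve J (fun_of (c *\<^sub>R h)) x = c * convolve J (fun_of h) x" for x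
    by (simp add: convolve_def mult.left_commute)
  have "AE x in lborel. fun_of (dispersal (c *\<^sub>R h)) x = fun_of (c *\<^sub>R dispersal h) x"
    using fun_of_scaleR[of c h] fun_of_scaleR[of c "dispersal h"]
      fun_of_dispersal[of h] fun_of_dispersal[of "c *\<^sub>R h"]
    by eventually_elim (simp add: conv right_diff_distrib)
  then show "dispersal (c *\<^sub>R h) = c *\<^sub>R dispersal h"
    by (simp add: L1_eq_iff)
  have abs_h: "integrable lborel (\<lambda>x. \<bar>fun_of h x\<bar>)" by simp
  \<comment> \<open>The constant 2 counts the mass of \<open>\<bar>h\<bar>\<close> twice: once for
    its convolution, which preserves mass, and once for \<open>h\<close> itself.\<close>
  have "norm (dispersal h) \<le> (LINT x|lborel. convolve J (\<lambda>x. \<bar>fun_of h x\<bar>) x + \<bar>fun_of h x\<bar>)"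
    unfolding norm_L1_fun_of
  proof (rule integral_mono_AE)
    show "AE x in lborel. \<bar>fun_of (dispersal h) x\<bar> \<le> convolve J (\<lambda>x. \<bar>fun_of h x\<bar>) x + \<bar>fun_of h x\<bar>"
      using fun_of_dispersal[of h]
    proof eventually_elim
      case (elim x)
      with abs_convolve_le[OF integrable_fun_of, of h x] show ?case by linarith
    qed
  qed (use integrable_convolve[OF abs_h] in auto)
  also have "\<dots> = norm h * 2"
    using integrable_convolve[OF abs_h] integral_convolve[OF abs_h] by (simp add: norm_L1_fun_of)
  finally show "norm (dispersal h) \<le> norm h * 2" .
qed

text \<open>For \<open>z = h - g\<close>, linearity turns the assumed inequality into
  \<open>0 \<le> J * z - z\<close> where \<open>z > 0\<close>, which is the hypothesis of
  \<open>comparison\<close>.\<close>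

lemma comparison_fun_of:
  assumes "AE x in lborel. fun_of g x < fun_of h x \<longrightarrow>
    fun_of (dispersal g) x \<le> fun_of (dispersal h) x"
  shows "AE x in lborel. fun_of h x \<le> fun_of g x"
proof -
  have "AE x in lborel. 0 < fun_of (h - g) x \<longrightarrow> fun_of (h - g) x \<le> convolve J (fun_of (h - g)) x"
    using assms fun_of_diff[of h g] fun_of_dispersal[of "h - g"] 
      fun_of_diff[of "dispersal h" "dispersal g"]
    by eventually_elim (auto simp: bounded_linear.linear[OF bounded_linear_dispersal] linear_diff)
  from comparison[OF integrable_fun_of this] show ?thesis
    using fun_of_diff[of h g] by eventually_elim simp
qed

end

section \<open>The Stefan flow and its time-integrated excess\<close>

locale stefan = kernel J for J :: "'a::euclidean_space \<Rightarrow> real" +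
  fixes f :: "'a \<Rightarrow> real" and u :: "real \<Rightarrow> 'a L1"
  assumes integrable_f: "integrable lborel f"
    and solution: "L1_solution J f u"
begin

definition v :: "real \<Rightarrow> 'a L1" where
  "v s = excess (u s)"

text \<open>The time integral of \<open>v\<close> (the Baiocchi variable), whose limit solves the obstacle problem.\<close>

definition W :: "real \<Rightarrow> 'a L1" where
  "W t = integral {0..t} v"

lemma continuous_on_v: "continuous_on {0..} v"
  unfolding v_def using solution
  by (intro continuous_on_compose2[OF continuous_on_excess[of UNIV]]) (auto simp: L1_solution_def)

lemma v_nonneg: "AE x in lborel. 0 \<le> fun_of (v s) x"
  using fun_of_excess[of "u s"] by eventually_elim (simp add: v_def)

lemma integrable_v: "0 \<le> a \<Longrightarrow> v integrable_on {a..b}"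
  by (rule integrable_continuous_real[OF continuous_on_subset[OF continuous_on_v]]) auto

lemma W_0: "W 0 = 0"
  by (simp add: W_def)

text \<open>A bounded linear operator commutes with the time integral, so the evolution depends on
  the past only through \<open>W t\<close>.\<close>

lemma u_eq:
  assumes "0 < t"
  shows "u t = L1_of f + dispersal (W t)"
proof -
  have "L1_of (\<lambda>x. convolve J (positive_excess (u s)) x - positive_excess (u s) x) = (dispersal \<circ> v) s" for s
    using dispersal_L1_of[OF integrable_excess[OF integrable_fun_of[of "u s"]]]
    by (simp add: v_def excess_def positive_excess_def [abs_def])
  then have "u t = L1_of f + integral {0..t} (dispersal \<circ> v)"
    using solution assms by (simp add: L1_solution_def Let_def o_def)
  also have "integral {0..t} (dispersal \<circ> v) = dispersal (W t)"
    unfolding W_def by (rule integral_linear[OF integrable_v bounded_linear_dispersal]) simp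
  finally show ?thesis .
qed

lemma W_diff: "0 \<le> s \<Longrightarrow> s \<le> t \<Longrightarrow> W t - W s = integral {s..t} v"
  unfolding W_def using Henstock_Kurzweil_Integration.integral_combine[where a=0 and c=s and b=t and f=v] integrable_v[of 0 t] by (simp add: algebra_simps)

lemma W_mono: "0 \<le> s \<Longrightarrow> s \<le> t \<Longrightarrow> AE x in lborel. 0 \<le> fun_of (W t - W s) x"
  by (simp add: W_diff fun_of_integral_nonneg integrable_v v_nonneg)

lemma W_nonneg: "0 \<le> t \<Longrightarrow> AE x in lborel. 0 \<le> fun_of (W t) x"
  using W_mono[of 0 t] by (simp add: W_0)

lemma W_has_vector_derivative:
  assumes "0 < s"
  shows "(W has_vector_derivative v s) (at s)"
proof -
  \<comment> \<open>The right end \<open>s + 1\<close> puts \<open>s\<close> in the interior, so the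
    one-interval derivative is two-sided.\<close>
  have "(W has_vector_derivative v s) (at s within {0..s + 1})"
    unfolding W_def
    by (rule integral_has_vector_derivative[OF continuous_on_subset[OF continuous_on_v]])
      (use assms in auto)
  then show ?thesis
    using assms by (simp add: at_within_Icc_at)
qed

lemma continuous_on_W: "continuous_on {0..t} W"
  unfolding W_def by (rule indefinite_integral_continuous_1[OF integrable_v]) simp

text \<open>On \<open>A = {u t < 1}\<close> one has \<open>v s \<le> W t - W s\<close> for \<open>s < t\<close>, because \<open>u\<close> decreases at
  rate at most \<open>v\<close>. Now apply a backward Gronwall argument to the integral over \<open>A\<close>.\<close>

lemma W_pos_imp_u_ge_1:
  assumes t: "0 < t"
  shows "AE x in lborel. 0 < fun_of (W t) x \<longrightarrow> 1 \<le> fun_of (u t) x"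
proof -
  define A where "A = {x. fun_of (u t) x < 1}"
  have A: "A \<in> sets borel" unfolding A_def by measurable
  interpret I: bounded_linear "integral_on A" by (rule bounded_linear_integral_on[OF A])
  have bound: "integral_on A (v s) \<le> integral_on A (W t - W s)" if s: "0 < s" "s < t" for s
  proof (rule integral_on_mono[OF A])
    have mono: "AE x in lborel. 0 \<le> fun_of (W t - W s) x"
      using s by (intro W_mono) auto
    then have conv: "0 \<le> convolve J (fun_of (W t - W s)) x" for x
      using convolve_mono[of "\<lambda>_. 0" "fun_of (W t - W s)" x] by (simp add: convolve_def)
    have eq: "u t - u s = dispersal (W t - W s)"
      using s by (simp add: u_eq bounded_linear.linear[OF bounded_linear_dispersal] linear_diff)
    show "AE x in lborel. x \<in> A \<longrightarrow> fun_of (v s) x \<le> fun_of (W t - W s) x"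
      using fun_of_diff[of "u t" "u s"] fun_of_dispersal[of "W t - W s"] fun_of_excess[of "u s"] mono
      unfolding v_def eq
    proof eventually_elim
      case (elim x)
      \<comment> \<open>With \<open>D = W t - W s\<close>, nonnegativity of \<open>J * D\<close>
        gives \<open>u s - D \<le> u t < 1\<close> on \<open>A\<close>, so
        \<open>u s - 1 < D\<close>; the other branch of the maximum is
        \<open>0 \<le> D\<close>.\<close>
      then show ?case using conv[of x] by (auto simp: A_def)
    qed
  qed
  \<comment> \<open>The factor \<open>exp s\<close> makes \<open>?Y\<close> nondecreasing by
    \<open>bound\<close>. It vanishes at \<open>t\<close> and equals the integral of
    \<open>W t\<close> over \<open>A\<close> at 0, so that integral is nonpositive.\<close>
  let ?Y = "\<lambda>s. exp s * integral_on A (W t - W s)"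
  have "?Y 0 \<le> ?Y t"
  proof (rule DERIV_nonneg_imp_increasing_open[where f="?Y"])
    fix s assume s: "0 < s" "s < t"
    have "((\<lambda>s. integral_on A (W t - W s)) has_real_derivative integral_on A (0 - v s)) (at s)"
      using W_has_vector_derivative[OF s(1)]
      unfolding has_real_derivative_iff_has_vector_derivative
      by (intro I.has_vector_derivative has_vector_derivative_diff has_vector_derivative_const)
    from DERIV_mult[OF DERIV_exp this]
    have "(?Y has_real_derivative exp s * (integral_on A (W t - W s) - integral_on A (v s))) (at s)"
      by (rule DERIV_cong) (simp add: I.diff I.neg algebra_simps)
    with bound[OF s] show "\<exists>y. (?Y has_real_derivative y) (at s) \<and> 0 \<le> y"
      by fastforce
  qed (use t in \<open>auto intro!: continuous_intros continuous_on_W I.continuous_on\<close>)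
  then have "integral_on A (W t) \<le> 0"
    by (simp add: W_0 I.zero)
  then have "AE x in lborel. x \<in> A \<longrightarrow> fun_of (W t) x = 0"
    using W_nonneg[of t] t by (intro integral_on_eq_0D[OF A]) (auto elim!: eventually_mono)
  then show ?thesis
    by eventually_elim (auto simp: A_def)
qed

section \<open>Comparison with the obstacle solution and passage to infinite time\<close>

lemma fun_of_u:
  assumes "0 < t"
  shows "AE x in lborel. fun_of (u t) x = f x + fun_of (dispersal (W t)) x"
  using fun_of_add[of "L1_of f" "dispersal (W t)"] fun_of_L1_of[OF integrable_f]
  by eventually_elim (simp add: u_eq[OF assms])

text \<open>Where \<open>W t > w \<ge> 0\<close>, the solution satisfies
  \<open>u t \<ge> 1 \<ge> f + dispersal w\<close>; cancelling \<open>f\<close> gives the premise of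
  the comparison.\<close>

lemma W_le_obstacle:
  assumes t: "0 < t" and w: "AE x in lborel. 0 \<le> fun_of w x"
    and le: "AE x in lborel. f x + fun_of (dispersal w) x \<le> 1"
  shows "AE x in lborel. fun_of (W t) x \<le> fun_of w x"
proof (rule comparison_fun_of)
  show "AE x in lborel. fun_of w x < fun_of (W t) x \<longrightarrow>
      fun_of (dispersal w) x \<le> fun_of (dispersal (W t)) x"
    using W_pos_imp_u_ge_1[OF t] fun_of_u[OF t] w le by eventually_elim auto
qed

text \<open>On the positive cone the norm is additive, so a norm-bounded increasing family is Cauchy.\<close>

lemma norm_W_diff:
  assumes "0 \<le> s" "s \<le> t"
  shows "norm (W t - W s) = integral_on UNIV (W t) - integral_on UNIV (W s)"
proof -
  interpret I: bounded_linear "integral_on (UNIV :: 'a set)"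
    by (rule bounded_linear_integral_on) simp
  have "norm (W t - W s) = integral_on UNIV (W t - W s)"
    unfolding norm_L1_fun_of integral_on_UNIV
    by (rule integral_cong_AE) (use W_mono[OF assms] in \<open>auto elim!: eventually_mono\<close>)
  then show ?thesis by (simp add: I.diff)
qed

lemma W_tendsto:
  assumes bd: "\<And>t. 0 < t \<Longrightarrow> integral_on UNIV (W t) \<le> B"
  obtains L where "(W \<longlongrightarrow> L) at_top"
proof -
  let ?m = "\<lambda>t. integral_on UNIV (W t)"
  define S where "S = (SUP t\<in>{0<..}. ?m t)"
  have bdd: "bdd_above (?m ` {0<..})"
    using bd by (intro bdd_aboveI2) auto
  have mono: "?m s \<le> ?m t" if "0 \<le> s" "s \<le> t" for s t
    using norm_W_diff[OF that] norm_ge_zero[of "W t - W s"] by simp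
  have "\<exists>T>0. \<forall>t\<ge>T. \<forall>s\<ge>T. dist (W t) (W s) < e" if "0 < e" for e
  proof -
    \<comment> \<open>After \<open>T\<close> the mass of \<open>W\<close> stays within
      \<open>e\<close> of its supremum, and by monotonicity mass differences are distances.\<close>
    obtain T where T: "0 < T" "S - e < ?m T"
      using less_cSUP_iff[OF _ bdd, of "S - e"] \<open>0 < e\<close> by (auto simp: S_def)
    have *: "dist (W t) (W s) < e" if "T \<le> s" "s \<le> t" for s t
    proof -
      have "?m t \<le> S" unfolding S_def using bdd T that by (intro cSUP_upper) auto
      then show ?thesis
        using norm_W_diff[of s t] mono[of T s] T that by (simp add: dist_norm)
    qed
    have "dist (W t) (W s) < e" if "T \<le> t" "T \<le> s" for s t
      using *[of s t] *[of t s] that by (cases "s \<le> t") (auto simp: dist_commute)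
    then show ?thesis using T by blast
  qed
  then have cauchy: "\<And>e. 0 < e \<Longrightarrow> \<exists>T. \<forall>t\<ge>T. \<forall>s\<ge>T. dist (W t) (W s) < e"
    by meson
  \<comment> \<open>Completeness yields a limit along integer times; the Cauchy bound at real times
    then extends it to all of them.\<close>
  have "Cauchy (\<lambda>n. W (real n))"
  proof (rule metric_CauchyI)
    fix e :: real assume "0 < e"
    then obtain T where T: "\<And>s t. T \<le> t \<Longrightarrow> T \<le> s \<Longrightarrow> dist (W t) (W s) < e"
      using cauchy by meson
    obtain M where "T \<le> real M" using real_arch_simple by blast
    then show "\<exists>M. \<forall>m\<ge>M. \<forall>n\<ge>M. dist (W (real m)) (W (real n)) < e"
      by (intro exI[of _ M] allI impI T) linarith+
  qed
  then obtain L where L: "(\<lambda>n. W (real n)) \<longlonglongrightarrow> L"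
    using Cauchy_convergent convergent_def by blast
  have "(W \<longlongrightarrow> L) at_top"
  proof (rule tendstoI)
    fix e :: real assume "0 < e"
    then obtain T where T: "\<And>s t. T \<le> t \<Longrightarrow> T \<le> s \<Longrightarrow> dist (W t) (W s) < e / 2"
      using cauchy[of "e / 2"] by auto
    obtain M where M: "T \<le> real M" using real_arch_simple by blast
    have "dist (W t) L \<le> e / 2" if "T \<le> t" for t
    proof (rule LIMSEQ_le_const2[OF tendsto_dist[OF tendsto_const L]])
      have "dist (W t) (W (real n)) \<le> e / 2" if "M \<le> n" for n
        using T[of t "real n"] \<open>T \<le> t\<close> M that by fastforce
      then show "\<exists>N. \<forall>n\<ge>N. dist (W t) (W (real n)) \<le> e / 2" by blast
    qed
    with \<open>0 < e\<close> show "\<forall>\<^sub>F t in at_top. dist (W t) L < e"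
      unfolding eventually_at_top_linorder by (intro exI[of _ T]) force
  qed
  then show thesis by (rule that)
qed

text \<open>If \<open>excess\<close> of the limit of \<open>u\<close> were positive, the total mass of \<open>W\<close> would grow linearly.\<close>

lemma limit_le_1:
  assumes W: "(W \<longlongrightarrow> L) at_top"
  shows "AE x in lborel. f x + fun_of (dispersal L) x \<le> 1"
proof -
  interpret I: bounded_linear "integral_on (UNIV :: 'a set)"
    by (rule bounded_linear_integral_on) simp
  let ?U = "L1_of f + dispersal L"
  have "((\<lambda>t. L1_of f + dispersal (W t)) \<longlongrightarrow> ?U) at_top"
    by (intro tendsto_add tendsto_const bounded_linear.tendsto[OF bounded_linear_dispersal] W)
  then have u: "(u \<longlongrightarrow> ?U) at_top"
    by (rule Lim_transform_eventually)
      (rule eventually_mono[OF eventually_gt_at_top[of 0]], simp add: u_eq)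
  have "(v \<longlongrightarrow> excess ?U) at_top"
    unfolding v_def by (rule continuous_on_tendsto_compose[OF continuous_on_excess[of UNIV] u]) auto
  then have mass_v: "((\<lambda>t. integral_on UNIV (v t)) \<longlongrightarrow> integral_on UNIV (excess ?U)) at_top"
    by (rule I.tendsto)
  let ?c = "integral_on UNIV (excess ?U)"
  have "?c \<le> 0"
  proof (rule ccontr)
    assume "\<not> ?c \<le> 0"
    then have c: "0 < ?c" by simp
    with order_tendstoD(1)[OF mass_v, of "?c / 2"]
    obtain T0 where T0: "\<And>t. T0 \<le> t \<Longrightarrow> ?c / 2 < integral_on UNIV (v t)"
      by (auto simp: eventually_at_top_linorder)
    define T where "T = max T0 0"
    have incr: "?c / 2 \<le> integral_on UNIV (W (t + 1) - W t)" if t: "T \<le> t" for t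
    proof -
      have v: "v integrable_on {t..t + 1}"
        using t by (intro integrable_v) (simp add: T_def)
      have "?c / 2 = integral {t..t + 1} (\<lambda>_. ?c / 2)" by simp
      also have "\<dots> \<le> integral {t..t + 1} (integral_on UNIV \<circ> v)"
        by (rule integral_le[OF _ integrable_linear[OF v I.bounded_linear_axioms]])
          (use T0 t in \<open>auto simp: T_def intro: less_imp_le\<close>)
      also have "\<dots> = integral_on UNIV (W (t + 1) - W t)"
        using integral_linear[OF v I.bounded_linear_axioms] W_diff[of t "t + 1"] t
        by (simp add: T_def)
      finally show ?thesis .
    qed
    have shift: "filterlim (\<lambda>t::real. t + 1) at_top at_top"
      by (rule filterlim_at_top_mono[OF filterlim_ident]) simp
    \<comment> \<open>Convergence of \<open>W\<close> sends the mass gained per unit time to 0,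
      against the lower bound \<open>?c / 2\<close>.\<close>
    have "((\<lambda>t. integral_on UNIV (W (t + 1) - W t)) \<longlongrightarrow> integral_on UNIV (L - L)) at_top"
      by (intro I.tendsto tendsto_diff W filterlim_compose[OF W shift])
    then have "?c / 2 \<le> integral_on UNIV (L - L)"
      by (rule tendsto_lowerbound) (use incr in \<open>auto simp: eventually_at_top_linorder\<close>)
    with c show False by (simp add: I.zero)
  qed
  moreover have "AE x in lborel. x \<in> UNIV \<longrightarrow> 0 \<le> fun_of (excess ?U) x"
    using fun_of_excess[of ?U] by eventually_elim simp
  ultimately have "AE x in lborel. x \<in> UNIV \<longrightarrow> fun_of (excess ?U) x = 0"
    by (intro integral_on_eq_0D) auto
  then show ?thesis
    using fun_of_excess[of ?U] fun_of_add[of "L1_of f" "dispersal L"] fun_of_L1_of[OF integrable_f]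
    by eventually_elim auto
qed

lemma u_tendsto:
  assumes w: "AE x in lborel. 0 \<le> fun_of w x"
    and le: "AE x in lborel. f x + fun_of (dispersal w) x \<le> 1"
    and eq: "AE x in lborel. 0 < fun_of w x \<longrightarrow> f x + fun_of (dispersal w) x = 1"
  shows "(u \<longlongrightarrow> L1_of f + dispersal w) at_top"
proof -
  have W_le: "AE x in lborel. fun_of (W t) x \<le> fun_of w x" if "0 < t" for t
    by (rule W_le_obstacle[OF that w le])
  have "integral_on UNIV (W t) \<le> integral_on UNIV w" if "0 < t" for t
    using W_le[OF that] by (intro integral_on_mono) auto
  then obtain L where L: "(W \<longlongrightarrow> L) at_top"
    by (rule W_tendsto)
  \<comment> \<open>Signs survive the \<open>L1\<close> limit because each
    \<open>integral_on A\<close> is continuous.\<close>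
  have L_nonneg: "AE x in lborel. 0 \<le> fun_of L x"
    unfolding fun_of_nonneg_iff
  proof
    fix A :: "'a set" assume A: "A \<in> sets borel"
    show "0 \<le> integral_on A L"
      by (rule tendsto_lowerbound[OF bounded_linear.tendsto[OF bounded_linear_integral_on[OF A] L]])
        (simp_all add: eventually_mono[OF eventually_ge_at_top[of 0]] integral_on_nonneg W_nonneg)
  qed
  have "AE x in lborel. 0 \<le> fun_of (w - L) x"
    unfolding fun_of_nonneg_iff
  proof
    fix A :: "'a set" assume A: "A \<in> sets borel"
    have nonneg: "0 \<le> integral_on A (w - W t)" if "0 < t" for t
    proof (rule integral_on_nonneg)
      show "AE x in lborel. 0 \<le> fun_of (w - W t) x"
        using W_le[OF that] fun_of_diff[of w "W t"] by eventually_elim simp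
    qed
    show "0 \<le> integral_on A (w - L)"
      by (rule tendsto_lowerbound[OF bounded_linear.tendsto
            [OF bounded_linear_integral_on[OF A] tendsto_diff[OF tendsto_const L]]])
        (simp_all add: eventually_mono[OF eventually_gt_at_top[of 0]] nonneg)
  qed
  then have L_le: "AE x in lborel. fun_of L x \<le> fun_of w x"
    using fun_of_diff[of w L] by eventually_elim simp
  have "AE x in lborel. fun_of w x \<le> fun_of L x"
  proof (rule comparison_fun_of)
    \<comment> \<open>Where \<open>w > L \<ge> 0\<close>, complementarity gives
      \<open>f + dispersal w = 1\<close>, while \<open>f + dispersal L \<le> 1\<close>.\<close>
    show "AE x in lborel. fun_of L x < fun_of w x \<longrightarrow>
        fun_of (dispersal L) x \<le> fun_of (dispersal w) x"
      using limit_le_1[OF L] eq L_nonneg by eventually_elim auto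
  qed
  with L_le have "AE x in lborel. fun_of L x = fun_of w x"
    by eventually_elim simp
  then have "L = w" by (simp add: L1_eq_iff)
  have "((\<lambda>t. L1_of f + dispersal (W t)) \<longlongrightarrow> L1_of f + dispersal w) at_top"
    using L unfolding \<open>L = w\<close>
    by (intro tendsto_add tendsto_const bounded_linear.tendsto[OF bounded_linear_dispersal])
  then show ?thesis
    by (rule Lim_transform_eventually)
      (rule eventually_mono[OF eventually_gt_at_top[of 0]], simp add: u_eq)
qed

end

theorem theorem5p4:
  fixes J f w :: "'a::euclidean_space \<Rightarrow> real" and u :: "real \<Rightarrow> 'a L1"
  assumes "admissible_kernel J"
    and "integrable lborel f" and "AE x in lborel. 0 \<le> f x"
    and "DIM('a) = 1 \<or> DIM('a) = 2 \<longrightarrow>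
      radially_nonincreasing J \<and>
      (\<exists>g. integrable lborel g \<and> g \<in> C0 \<and> (\<forall>x. 0 \<le> g x) \<and> radial g \<and>
        radially_strictly_decreasing g \<and> (AE x in lborel. 0 \<le> f x \<and> f x \<le> g x))"
    and "L1_solution J f u"
    and "obstacle_solution J f w"
  shows "(u \<longlongrightarrow> L1_of (\<lambda>x. f x + convolve J w x - w x)) at_top"
proof -
  interpret stefan J f u
    by unfold_locales (use assms in auto)
  have w: "integrable lborel w" "AE x in lborel. 0 \<le> w x"
    and le: "AE x in lborel. 0 \<le> f x + convolve J w x - w x \<and> f x + convolve J w x - w x \<le> 1"
    and eq: "AE x in lborel. (f x + convolve J w x - w x - 1) * w x = 0"
    using assms(6) by (auto simp: obstacle_solution_def)
  have int: "integrable lborel (\<lambda>x. convolve J w x - w x)"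
    using w by (simp add: integrable_convolve)
  have disp: "AE x in lborel. fun_of (dispersal (L1_of w)) x = convolve J w x - w x"
    using fun_of_L1_of[OF int] by (simp add: dispersal_L1_of w)
  note w' = fun_of_L1_of[OF w(1)]
  have "(u \<longlongrightarrow> L1_of f + dispersal (L1_of w)) at_top"
  proof (rule u_tendsto)
    show "AE x in lborel. 0 \<le> fun_of (L1_of w) x"
      using w' w(2) by eventually_elim simp
    show "AE x in lborel. f x + fun_of (dispersal (L1_of w)) x \<le> 1"
      using disp le by eventually_elim simp
    \<comment> \<open>A positive value of \<open>w\<close> cancels from the complementarity
      product.\<close>
    show "AE x in lborel. 0 < fun_of (L1_of w) x \<longrightarrow> f x + fun_of (dispersal (L1_of w)) x = 1"
      using disp eq w' by eventually_elim auto
  qed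
  also have "L1_of f + dispersal (L1_of w) = L1_of (\<lambda>x. f x + convolve J w x - w x)"
    using L1_of_add[OF integrable_f int] by (simp add: dispersal_L1_of w add_diff_eq)
  finally show ?thesis .
qed

end
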